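(* The class $\mathcal{R}_3$ contains the Petersen graph, every prism $\mathrm{Pr}_n$ ($n\geq 3$), and every graph obtained from any of these by applying operations 1 and 2 an arbitrary number of times in any order, where operation 1 attaches to a vertex $v$ of the current graph a simple path of any length $\ell\geq 1$ whose other $\ell$ vertices are new, and operation 2 joins two vertices $x,y$ of the current graph by a simple path of length at least $3$ whose internal vertices are new.
   Context: All graphs are finite and simple. For a word $w$ and distinct letters $x,y$ occurring in $w$, $x$ and $y$ alternate in $w$ if deleting all letters other than copies of $x$ and $y$ from $w$ yields a word of the form $xyxy\cdots$ or $yxyx\cdots$ (of even or odd length). A graph $G=(V,E)$ is word-representable if there is a word $w$ over the alphabet $V$ (each vertex occurring in $w$) such that for all distinct $x,y\in V$, $x$ and $y$ alternate in $w$ if and only if $(x,y)\in E$. A word is $k$-uniform if each of its letters occurs exactly $k$ times; $G$ is $k$-word-representable if some $k$-uniform word represents it. The representation number $\mathcal{R}(G)$ of a word-representable graph is the least such $k$, and $\mathcal{R}_k$ denotes the class of word-representable graphs with representation number exactly $k$. For $n\geq 3$, the prism $\mathrm{Pr}_n$ consists of two cycles $1\,2\cdots n$ and $1'2'\cdots n'$ together with the edges $(i,i')$, $i=1,\ldots,n$. The length of a path is its number of edges. *)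

theory Defs
  imports Main
begin

type_synonym graph = "nat set \<times> nat set set"

definition verts :: "graph \<Rightarrow> nat set" where "verts G = fst G"
definition edges :: "graph \<Rightarrow> nat set set" where "edges G = snd G"

definition simple_graph :: "graph \<Rightarrow> bool" where
  "simple_graph G \<longleftrightarrow> finite (verts G) \<and>
     (\<forall>e\<in>edges G. \<exists>x y. x \<in> verts G \<and> y \<in> verts G \<and> x \<noteq> y \<and> e = {x, y})"

definition alternating_word :: "nat \<Rightarrow> nat \<Rightarrow> nat list \<Rightarrow> bool" where
  "alternating_word a b u \<longleftrightarrow> u = map (\<lambda>i. if even i then a else b) [0..<length u]"

definition alternate :: "nat list \<Rightarrow> nat \<Rightarrow> nat \<Rightarrow> bool" where
  "alternate w x y \<longleftrightarrow>
     (let u = filter (\<lambda>z. z = x \<or> z = y) w in alternating_word x y u \<or> alternating_word y x u)"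

definition represents :: "nat list \<Rightarrow> graph \<Rightarrow> bool" where
  "represents w G \<longleftrightarrow> set w = verts G \<and>
     (\<forall>x\<in>verts G. \<forall>y\<in>verts G. x \<noteq> y \<longrightarrow> (alternate w x y \<longleftrightarrow> {x, y} \<in> edges G))"

definition word_representable :: "graph \<Rightarrow> bool" where
  "word_representable G \<longleftrightarrow> (\<exists>w. represents w G)"

definition uniform :: "nat \<Rightarrow> nat list \<Rightarrow> bool" where
  "uniform k w \<longleftrightarrow> (\<forall>x\<in>set w. count_list w x = k)"

definition k_word_representable :: "nat \<Rightarrow> graph \<Rightarrow> bool" where
  "k_word_representable k G \<longleftrightarrow> (\<exists>w. uniform k w \<and> represents w G)"

definition rep_number :: "graph \<Rightarrow> nat" where
  "rep_number G = (LEAST k. k_word_representable k G)"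

definition R_class :: "nat \<Rightarrow> graph set" where
  "R_class k = {G. simple_graph G \<and> word_representable G \<and> rep_number G = k}"

definition path_edges :: "nat list \<Rightarrow> nat set set" where
  "path_edges xs = {{xs ! i, xs ! Suc i} | i. Suc i < length xs}"

definition petersen :: graph where
  "petersen = ({0..<10},
     {{i, (i + 1) mod 5} | i. i < 5} \<union>
     {{5 + i, 5 + (i + 2) mod 5} | i. i < 5} \<union>
     {{i, 5 + i} | i. i < 5})"

definition prism :: "nat \<Rightarrow> graph" where
  "prism n = ({0..<2 * n},
     {{i, (i + 1) mod n} | i. i < n} \<union>
     {{n + i, n + (i + 1) mod n} | i. i < n} \<union>
     {{i, n + i} | i. i < n})"

text \<open>Operation 1: attach to v a path of length l = length p \<ge> 1 whose other
  l vertices (the list p) are new.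
  Operation 2: join distinct x, y by a path of length length p + 1 \<ge> 3 whose
  internal vertices (the list p) are new.\<close>
inductive_set derived_graphs :: "graph set" where
  base_petersen: "petersen \<in> derived_graphs"
| base_prism: "n \<ge> 3 \<Longrightarrow> prism n \<in> derived_graphs"
| op1: "G \<in> derived_graphs \<Longrightarrow> v \<in> verts G \<Longrightarrow> length p \<ge> 1 \<Longrightarrow> distinct p \<Longrightarrow>
        set p \<inter> verts G = {} \<Longrightarrow>
        (verts G \<union> set p, edges G \<union> path_edges (v # p)) \<in> derived_graphs"
| op2: "G \<in> derived_graphs \<Longrightarrow> x \<in> verts G \<Longrightarrow> y \<in> verts G \<Longrightarrow> x \<noteq> y \<Longrightarrow>
        length p \<ge> 2 \<Longrightarrow> distinct p \<Longrightarrow> set p \<inter> verts G = {} \<Longrightarrow>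
        (verts G \<union> set p, edges G \<union> path_edges (x # p @ [y])) \<in> derived_graphs"

end

theory Submission
  imports Defs
begin

text \<open>
  Lower bound. In a 2-uniform word the letters are chords of a circle, alternation being crossing, so
  orienting the chords gives a solution over the two-element field of Naji's linear equations. They
  are contradictory on a claw each two of whose leaves are joined by a path avoiding the closed
  neighbourhood of the third leaf, which the Petersen graph and the prisms with \<open>n \<ge> 4\<close> contain;
  for \<open>n = 3\<close> one adds up other equations. Both operations keep the old graph as an induced
  subgraph, to which words can be restricted.

  Upper bound. The prisms with \<open>n \<ge> 5\<close> have a periodic 3-uniform word, the remaining base graphs
  explicit ones. A leaf \<open>u\<close> at \<open>v\<close> is obtained by turning \<open>A v B v C v D\<close> into
  \<open>A uvu B v C uv D\<close>: the factor \<open>uvu\<close> prevents \<open>u\<close> from alternating with any letter but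
  \<open>v\<close>. A path \<open>a, u, t, b\<close> is obtained by turning \<open>A a B b C\<close>, where \<open>B\<close> contains \<open>a\<close> and
  \<open>b\<close> once each, into \<open>A uatu B tbut C\<close>. For any two letters \<open>x, y\<close> of a 3-uniform word such a
  factorization exists with \<open>{a, b} = {x, y}\<close>. Longer paths arise by first attaching leaves.
\<close>

section \<open>Alternation in terms of positions\<close>

lemma alternating_word_Cons:
  "alternating_word a b (z # u) \<longleftrightarrow> z = a \<and> alternating_word b a u"
proof -
  have "map (\<lambda>i. if even i then a else b) [0..<Suc (length u)]
      = a # map (\<lambda>i. if even i then b else a) [0..<length u]"
    by (subst map_upt_Suc) simp
  then show ?thesis by (simp add: alternating_word_def del: upt_Suc)
qed

lemma alternating_word_iff:
  assumes "a \<noteq> b" "set u \<subseteq> {a, b}"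
  shows "alternating_word a b u \<longleftrightarrow> distinct_adj u \<and> (u = [] \<or> hd u = a)"
  using assms
proof (induction u arbitrary: a b)
  case Nil
  then show ?case by (simp add: alternating_word_def)
next
  case (Cons z u)
  then have "alternating_word b a u \<longleftrightarrow> distinct_adj u \<and> (u = [] \<or> hd u = b)"
    by (simp add: insert_commute)
  moreover have "u = [] \<or> hd u = a \<or> hd u = b"
    using Cons.prems by (cases u) auto
  ultimately show ?case
    using Cons.prems by (auto simp: alternating_word_Cons distinct_adj_Cons)
qed

text \<open>A word over two letters without equal neighbours is determined by its length and its
  first letter, so the two disjuncts of the definition merge into one symmetric condition.\<close>

lemma alternate_iff_distinct_adj:
  assumes "x \<noteq> y"
  shows "alternate w x y \<longleftrightarrow> distinct_adj (filter (\<lambda>z. z = x \<or> z = y) w)"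
proof -
  let ?u = "filter (\<lambda>z. z = x \<or> z = y) w"
  have s: "set ?u \<subseteq> {x, y}" by auto
  then have "?u = [] \<or> hd ?u = x \<or> hd ?u = y"
    by (metis (no_types, lifting) hd_in_set insertE singletonD subsetD)
  then show ?thesis
    using alternating_word_iff[OF assms s] alternating_word_iff[OF assms[symmetric], of ?u] s
    by (auto simp: alternate_def Let_def insert_commute)
qed

lemma alternate_commute: "alternate w x y \<longleftrightarrow> alternate w y x"
  by (simp add: alternate_def Let_def disj_commute)

lemma not_distinct_adj_split:
  "\<not> distinct_adj u \<Longrightarrow> \<exists>A z B. u = A @ z # z # B"
proof (induction u rule: induct_list012)
  case (3 x y zs)
  then show ?case
    by (metis append_Cons append_Nil distinct_adj_Cons_Cons)
qed auto

lemma filter_eq_appendD: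
  "filter P w = A @ B \<Longrightarrow> \<exists>us vs. w = us @ vs \<and> filter P us = A \<and> filter P vs = B"
proof (induction w arbitrary: A)
  case (Cons z w)
  show ?case
  proof (cases "A = []")
    case True
    then show ?thesis using Cons.prems by (metis append_Nil filter.simps(1))
  next
    case False
    then obtain A' where "filter P w = A' @ B" "A = (if P z then z # A' else A')"
      using Cons.prems by (cases A) (auto split: if_splits)
    then show ?thesis using Cons.IH[of A'] by (metis append_Cons filter.simps(2))
  qed
qed auto

definition occurrences :: "nat list \<Rightarrow> nat \<Rightarrow> nat set" where
  "occurrences w x = {p. p < length w \<and> w ! p = x}"

text \<open>Quantifying over all pairs in \<open>S\<close> spares an enumeration of
  \<open>S\<close>; a point between neighbours also lies between every pair enclosing them.\<close>

definition separates :: "nat set \<Rightarrow> nat set \<Rightarrow> bool" where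
  "separates T S \<longleftrightarrow> (\<forall>p\<in>S. \<forall>q\<in>S. p < q \<longrightarrow> (\<exists>r\<in>T. p < r \<and> r < q))"

lemma card_occurrences: "card (occurrences w x) = count_list w x"
  by (simp add: occurrences_def count_list_eq_length_filter length_filter_conv_card eq_commute)

lemma occurrences_disjoint: "p \<in> occurrences w x \<Longrightarrow> p \<in> occurrences w y \<Longrightarrow> x = y"
  by (simp add: occurrences_def)

text \<open>Bridge between two views: positions suit the arguments about the order of chord ends and
  of triples, factors suit the passage to the filtered word.\<close>

lemma separates_occurrences_iff:
  "separates (occurrences w y) (occurrences w x)
     \<longleftrightarrow> (\<forall>A B C. w = A @ x # B @ x # C \<longrightarrow> y \<in> set B)"
proof (intro iffI allI impI)
  fix A B C
  assume sep: "separates (occurrences w y) (occurrences w x)" and w: "w = A @ x # B @ x # C"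
  have "length A \<in> occurrences w x" "length A + 1 + length B \<in> occurrences w x"
    by (auto simp: w occurrences_def nth_append)
  then obtain r where r: "r \<in> occurrences w y" "length A < r" "r < length A + 1 + length B"
    using sep by (force simp: separates_def)
  then have "y = B ! (r - length A - 1)"
    by (auto simp: w occurrences_def nth_append nth_Cons')
  moreover have "r - length A - 1 < length B" using r by auto
  ultimately show "y \<in> set B" by simp
next
  assume *: "\<forall>A B C. w = A @ x # B @ x # C \<longrightarrow> y \<in> set B"
  show "separates (occurrences w y) (occurrences w x)"
    unfolding separates_def
  proof (intro ballI impI)
    fix p q assume pq: "p \<in> occurrences w x" "q \<in> occurrences w x" "p < q"
    define B where "B = drop (Suc p) (take q w)"
    have q: "q < length w" "w ! q = x" "w ! p = x" using pq by (auto simp: occurrences_def)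
    have "w = take q w @ x # drop (Suc q) w" using q by (metis id_take_nth_drop)
    moreover have "take q w = take p w @ x # B"
      using id_take_nth_drop[of p "take q w"] pq q by (simp add: B_def min_def)
    ultimately have "w = take p w @ x # B @ x # drop (Suc q) w" by simp
    then have "y \<in> set B" using * by blast
    then obtain i where "i < length B" "B ! i = y" by (auto simp: in_set_conv_nth)
    then show "\<exists>r\<in>occurrences w y. p < r \<and> r < q"
      using q pq by (intro bexI[of _ "Suc p + i"]) (auto simp: B_def occurrences_def)
  qed
qed

lemma alternate_iff_separates:
  assumes "x \<noteq> y"
  shows "alternate w x y \<longleftrightarrow> separates (occurrences w y) (occurrences w x)
    \<and> separates (occurrences w x) (occurrences w y)"
proof -
  let ?P = "\<lambda>z. z = x \<or> z = y"
  \<comment> \<open>Under the filter, a factor \<open>a B a\<close> free of \<open>b\<close> shrinks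
    to a power of \<open>a\<close> with exponent at least 2.\<close>
  have 1: "\<not> distinct_adj (filter ?P (A @ a # B @ a # C))"
    if "b \<notin> set B" "{a, b} = {x, y}" for A B C a b
  proof -
    have "filter ?P B = replicate (length (filter ?P B)) a"
      using that by (subst replicate_length_same) (auto simp: doubleton_eq_iff)
    then obtain n where n: "filter ?P B = replicate n a" by blast
    have "?P a" using that by auto
    then have "filter ?P (A @ a # B @ a # C) = filter ?P A @ a # a # replicate n a @ filter ?P C"
      by (simp add: n replicate_app_Cons_same)
    then show ?thesis by (simp add: distinct_adj_append_iff)
  qed
  \<comment> \<open>Conversely, equal neighbours of the filtered word come from two occurrences in
    \<open>w\<close> with neither letter between them.\<close>
  have 2: "\<exists>A B C a b. w = A @ a # B @ a # C \<and> b \<notin> set B \<and> {a, b} = {x, y}"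
    if "\<not> distinct_adj (filter ?P w)"
  proof -
    obtain A z B where "filter ?P w = A @ z # z # B"
      using not_distinct_adj_split[OF \<open>\<not> distinct_adj _\<close>] by blast
    then obtain us vs where w: "w = us @ vs" "filter ?P vs = z # z # B"
      by (auto dest: filter_eq_appendD)
    then obtain us' vs' where v: "vs = us' @ z # vs'" "?P z" "filter ?P vs' = z # B"
      using filter_eq_ConsD[OF w(2)] by metis
    then obtain us'' vs'' where v': "vs' = us'' @ z # vs''" "\<forall>u\<in>set us''. \<not> ?P u"
      using filter_eq_ConsD[OF v(3)] by metis
    have "w = (us @ us') @ z # us'' @ z # vs''" using w v v' by simp
    moreover have "x \<notin> set us''" "y \<notin> set us''" using v' by auto
    ultimately show ?thesis using v(2) by (metis insert_commute)
  qed
  show ?thesis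
    unfolding alternate_iff_distinct_adj[OF assms] separates_occurrences_iff
  proof (intro iffI conjI allI impI)
    fix A B C assume "distinct_adj (filter ?P w)" "w = A @ x # B @ x # C"
    then show "y \<in> set B" using 1[of y B x A C] by blast
  next
    fix A B C assume "distinct_adj (filter ?P w)" "w = A @ y # B @ y # C"
    then show "x \<in> set B" using 1[of x B y A C] by blast
  next
    assume sep: "(\<forall>A B C. w = A @ x # B @ x # C \<longrightarrow> y \<in> set B) \<and>
      (\<forall>A B C. w = A @ y # B @ y # C \<longrightarrow> x \<in> set B)"
    show "distinct_adj (filter ?P w)"
    proof (rule ccontr)
      assume "\<not> distinct_adj (filter ?P w)"
      then obtain A B C a b where w: "w = A @ a # B @ a # C" and b: "b \<notin> set B" "{a, b} = {x, y}"
        using 2 by blast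
      then consider "a = x" "b = y" | "a = y" "b = x" by (auto simp: doubleton_eq_iff)
      then show False using sep w b by cases blast+
    qed
  qed
qed

section \<open>Graphs that are not 2-word-representable\<close>

text \<open>Naji's system for circle graphs: truth values stand for 1 and 0, and
  \<open>\<noteq>\<close> for a sum equal to 1. The last clause is thus the linear equation
  \<open>\<beta> v w + \<beta> w v + \<beta> x v + \<beta> x w = 1\<close>.\<close>

definition naji_solution :: "graph \<Rightarrow> (nat \<Rightarrow> nat \<Rightarrow> bool) \<Rightarrow> bool" where
  "naji_solution G \<beta> \<longleftrightarrow>
     (\<forall>v\<in>verts G. \<forall>w\<in>verts G. v \<noteq> w \<longrightarrow> {v, w} \<in> edges G \<longrightarrow> \<beta> v w \<noteq> \<beta> w v) \<and>
     (\<forall>x\<in>verts G. \<forall>v\<in>verts G. \<forall>w\<in>verts G. x \<noteq> v \<longrightarrow> x \<noteq> w \<longrightarrow> v \<noteq> w \<longrightarrow>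
        {v, w} \<in> edges G \<longrightarrow> {x, v} \<notin> edges G \<longrightarrow> {x, w} \<notin> edges G \<longrightarrow> \<beta> x v = \<beta> x w) \<and>
     (\<forall>x\<in>verts G. \<forall>v\<in>verts G. \<forall>w\<in>verts G. x \<noteq> v \<longrightarrow> x \<noteq> w \<longrightarrow> v \<noteq> w \<longrightarrow>
        {v, w} \<notin> edges G \<longrightarrow> {x, v} \<in> edges G \<longrightarrow> {x, w} \<in> edges G \<longrightarrow>
        (\<beta> v w \<noteq> \<beta> w v) = (\<beta> x v = \<beta> x w))"

text \<open>\<open>\<beta> x y\<close> tells on which side of the chord \<open>x\<close>, oriented from its first to its second
  occurrence, the chord \<open>y\<close> starts.\<close>
lemma naji_solution_exists:
  assumes "k_word_representable 2 G"
  shows "\<exists>\<beta>. naji_solution G \<beta>"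
proof -
  obtain w where assms: "uniform 2 w" "represents w G"
    using assms by (auto simp: k_word_representable_def)
  define f where "f x = Min (occurrences w x)" for x
  define l where "l x = Max (occurrences w x)" for x
  have occ: "occurrences w x = {f x, l x}" "f x < l x" if "x \<in> verts G" for x
  proof -
    have "card (occurrences w x) = 2"
      using that assms by (simp add: card_occurrences uniform_def represents_def)
    then obtain a b where "occurrences w x = {a, b}" "a < b"
      by (metis card_2_iff insert_commute linorder_neqE_nat)
    then show "occurrences w x = {f x, l x}" "f x < l x" by (auto simp: f_def l_def)
  qed
  have dist: "f x \<noteq> f y" "f x \<noteq> l y" "l x \<noteq> f y" "l x \<noteq> l y"
    if "x \<in> verts G" "y \<in> verts G" "x \<noteq> y" for x y
    using occ(1)[OF that(1)] occ(1)[OF that(2)] occurrences_disjoint[of _ w x y] that(3) by auto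
  have edge: "{x, y} \<in> edges G \<longleftrightarrow> f x < f y \<and> f y < l x \<and> l x < l y \<or> f y < f x \<and> f x < l y \<and> l y < l x"
    if "x \<in> verts G" "y \<in> verts G" "x \<noteq> y" for x y
  proof -
    have "{x, y} \<in> edges G \<longleftrightarrow> alternate w x y"
      using assms that by (auto simp: represents_def)
    also have "\<dots> \<longleftrightarrow> f x < f y \<and> f y < l x \<and> l x < l y \<or> f y < f x \<and> f x < l y \<and> l y < l x"
      using occ(2)[OF that(1)] occ(2)[OF that(2)] dist[OF that]
      unfolding alternate_iff_separates[OF that(3)] separates_def occ(1)[OF that(1)] occ(1)[OF that(2)]
      by auto
    finally show ?thesis .
  qed
  \<comment> \<open>Two chords that do not cross are disjoint or nested, which gives these four
    orders of their ends.\<close>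
  have nonedge: "l x < f y \<or> l y < f x \<or> f x < f y \<and> l y < l x \<or> f y < f x \<and> l x < l y"
    if "x \<in> verts G" "y \<in> verts G" "x \<noteq> y" "{x, y} \<notin> edges G" for x y
    using edge[OF that(1-3)] that(4) occ(2)[OF that(1)] occ(2)[OF that(2)] dist[OF that(1-3)]
    by linarith
  show ?thesis
    unfolding naji_solution_def
  proof (intro exI[of _ "\<lambda>x y. f x < f y \<and> f y < l x"] conjI ballI impI)
    fix v w assume v: "v \<in> verts G" "w \<in> verts G" "v \<noteq> w" "{v, w} \<in> edges G"
    then show "(f v < f w \<and> f w < l v) \<noteq> (f w < f v \<and> f v < l w)"
      using edge[OF v(1-3)] occ(2)[OF v(1)] occ(2)[OF v(2)] by auto
  next
    fix x v w assume v: "x \<in> verts G" "v \<in> verts G" "w \<in> verts G" "x \<noteq> v" "x \<noteq> w" "v \<noteq> w"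
      and e: "{v, w} \<in> edges G" "{x, v} \<notin> edges G" "{x, w} \<notin> edges G"
    \<comment> \<open>Each of the three pairs of chords gets one of its order types; every
      combination is either contradictory or fixes both sides of the equation.\<close>
    note e(1)[unfolded edge[OF v(2,3,6)]] nonedge[OF v(1,2,4) e(2)] nonedge[OF v(1,3,5) e(3)]
    then show "(f x < f v \<and> f v < l x) = (f x < f w \<and> f w < l x)"
      using occ(2)[OF v(1)] occ(2)[OF v(2)] occ(2)[OF v(3)]
      by (elim disjE conjE) simp_all
  next
    fix x v w assume v: "x \<in> verts G" "v \<in> verts G" "w \<in> verts G" "x \<noteq> v" "x \<noteq> w" "v \<noteq> w"
      and e: "{v, w} \<notin> edges G" "{x, v} \<in> edges G" "{x, w} \<in> edges G"
    note nonedge[OF v(2,3,6) e(1)] e(2)[unfolded edge[OF v(1,2,4)]] e(3)[unfolded edge[OF v(1,3,5)]]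
    then show "((f v < f w \<and> f w < l v) \<noteq> (f w < f v \<and> f v < l w)) =
       ((f x < f v \<and> f v < l x) = (f x < f w \<and> f w < l x))"
      using occ(2)[OF v(1)] occ(2)[OF v(2)] occ(2)[OF v(3)]
      by (elim disjE conjE) simp_all
  qed
qed

text \<open>\<open>rep_number\<close> is a least value over all \<open>k\<close>, so every value
  below 3 has to be excluded. In this form the bound passes from an induced subgraph to the whole
  graph.\<close>

definition rep_ge3 :: "graph \<Rightarrow> bool" where
  "rep_ge3 G \<longleftrightarrow> (\<forall>k<3. \<not> k_word_representable k G)"

lemma not_0_word_representable: "v \<in> verts G \<Longrightarrow> \<not> k_word_representable 0 G"
  by (auto simp: k_word_representable_def uniform_def represents_def count_list_0_iff)

text \<open>A letter that occurs once leaves nothing to be separated, so all pairs alternate and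
  only complete graphs are represented.\<close>

lemma not_1_word_representable:
  assumes "v \<in> verts G" "w \<in> verts G" "v \<noteq> w" "{v, w} \<notin> edges G"
  shows "\<not> k_word_representable 1 G"
proof
  assume "k_word_representable 1 G"
  then obtain u where u: "uniform 1 u" "represents u G" by (auto simp: k_word_representable_def)
  have sep: "separates T (occurrences u x)" if "x \<in> verts G" for T x
  proof -
    have "card (occurrences u x) = 1"
      using that u by (simp add: card_occurrences uniform_def represents_def)
    then show ?thesis by (auto simp: card_1_singleton_iff separates_def)
  qed
  then have "alternate u v w" using assms by (simp add: alternate_iff_separates)
  then show False using u assms by (auto simp: represents_def)
qed

lemma rep_ge3I:
  assumes "v \<in> verts G" "w \<in> verts G" "v \<noteq> w" "{v, w} \<notin> edges G"
    and "\<not> k_word_representable 2 G"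
  shows "rep_ge3 G"
proof -
  have "k = 0 \<or> k = 1 \<or> k = 2" if "k < 3" for k :: nat using that by linarith
  then show ?thesis
    unfolding rep_ge3_def
    using assms not_0_word_representable[OF assms(1)] not_1_word_representable[OF assms(1-4)] by metis
qed

text \<open>The walks along which \<open>\<beta> a\<close> is constant: every step is an edge
  outside the closed neighbourhood of \<open>a\<close>, as in the second kind of Naji equation.
  \<open>distinct_adj\<close> provides the distinct ends that this equation asks for.\<close>

definition linked_off :: "graph \<Rightarrow> nat \<Rightarrow> nat list \<Rightarrow> bool" where
  "linked_off G a p \<longleftrightarrow> p \<noteq> [] \<and> set p \<subseteq> {v \<in> verts G. v \<noteq> a \<and> {a, v} \<notin> edges G} \<and>
     distinct_adj p \<and> successively (\<lambda>u v. {u, v} \<in> edges G) p"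

text \<open>The three walks yield \<open>\<beta> a b = \<beta> a c\<close>,
  \<open>\<beta> b a = \<beta> b c\<close> and \<open>\<beta> c a = \<beta> c b\<close>, so the sum
  of \<open>\<beta>\<close> over all ordered pairs of leaves is 0. Adding the equations of the third
  kind at \<open>x\<close> for the three pairs of leaves, the terms in \<open>x\<close> cancel and
  the same sum becomes 1.\<close>

lemma claw_rep_ge3:
  assumes "x \<in> verts G" "x \<noteq> a" "x \<noteq> b" "x \<noteq> c" "a \<noteq> b" "a \<noteq> c" "b \<noteq> c"
    and "a \<in> verts G" "b \<in> verts G" "c \<in> verts G"
    and "{x, a} \<in> edges G" "{x, b} \<in> edges G" "{x, c} \<in> edges G"
    and pa: "linked_off G a pa" "hd pa = b" "last pa = c"
    and pb: "linked_off G b pb" "hd pb = a" "last pb = c"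
    and pc: "linked_off G c pc" "hd pc = a" "last pc = b"
  shows "rep_ge3 G"
proof -
  \<comment> \<open>The walks start and end at the other two leaves, so the nonadjacency of the
    leaves is read off from the ends of the walks.\<close>
  have ends: "{h, hd p} \<notin> edges G" "{h, last p} \<notin> edges G" if "linked_off G h p" for h p
    using that hd_in_set[of p] last_in_set[of p] unfolding linked_off_def by blast+
  note nab = ends(1)[OF pa(1)] and nac = ends(2)[OF pa(1)] and nbc = ends(2)[OF pb(1)]
  show ?thesis
  proof (rule rep_ge3I)
    show "{a, b} \<notin> edges G" using nab pa by simp
    show "\<not> k_word_representable 2 G"
    proof
      assume "k_word_representable 2 G"
      then obtain \<beta> where \<beta>: "naji_solution G \<beta>" using naji_solution_exists by blast
      have const: "\<beta> h (hd p) = \<beta> h (last p)" if "linked_off G h p" "h \<in> verts G" for h p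
        using that(1)
      proof (induction p rule: induct_list012)
        case (3 u v p)
        then have "linked_off G h (v # p)" by (auto simp: linked_off_def)
        moreover have "\<beta> h u = \<beta> h v"
          using 3(3) \<open>h \<in> verts G\<close> \<beta> unfolding linked_off_def naji_solution_def by auto
        ultimately show ?case using 3(2) by simp
      qed (auto simp: linked_off_def)
      have "\<beta> a b = \<beta> a c" "\<beta> b a = \<beta> b c" "\<beta> c a = \<beta> c b"
        using const[OF pa(1)] const[OF pb(1)] const[OF pc(1)] pa pb pc assms by simp_all
      moreover have "(\<beta> a b \<noteq> \<beta> b a) = (\<beta> x a = \<beta> x b)" "(\<beta> a c \<noteq> \<beta> c a) = (\<beta> x a = \<beta> x c)"
        "(\<beta> b c \<noteq> \<beta> c b) = (\<beta> x b = \<beta> x c)"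
        using \<beta> assms nab nac nbc unfolding naji_solution_def by auto
      ultimately show False by argo
    qed
  qed (use assms in auto)
qed

section \<open>Adjacency in the base graphs\<close>

lemma petersen_edge_iff:
  "{x, y} \<in> edges petersen \<longleftrightarrow>
     x < 5 \<and> y < 5 \<and> (y = (x + 1) mod 5 \<or> x = (y + 1) mod 5) \<or>
     5 \<le> x \<and> x < 10 \<and> 5 \<le> y \<and> y < 10 \<and> (y = 5 + (x - 5 + 2) mod 5 \<or> x = 5 + (y - 5 + 2) mod 5) \<or>
     x < 5 \<and> y = 5 + x \<or> y < 5 \<and> x = 5 + y" (is "?L \<longleftrightarrow> ?R")
proof
  assume ?L
  then show ?R by (auto simp: petersen_def edges_def doubleton_eq_iff)
next
  assume ?R
  then consider "x < 5" "y = (x + 1) mod 5" | "y < 5" "x = (y + 1) mod 5"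
    | "5 \<le> x" "x < 10" "y = 5 + (x - 5 + 2) mod 5"
    | "5 \<le> y" "y < 10" "x = 5 + (y - 5 + 2) mod 5"
    | "x < 5" "y = 5 + x" | "y < 5" "x = 5 + y"
    by blast
  then show ?L
  proof cases
    case 1 then show ?thesis unfolding petersen_def edges_def snd_conv by blast
  next
    case 2 then show ?thesis unfolding petersen_def edges_def snd_conv by blast
  next
    case 3
    \<comment> \<open>The inner vertices are numbered from 5, so the index demanded by the set
      comprehension is \<open>x - 5\<close>.\<close>
    then have "{x, y} = {5 + (x - 5), 5 + (x - 5 + 2) mod 5}" "x - 5 < 5" by auto
    then show ?thesis unfolding petersen_def edges_def snd_conv by blast
  next
    case 4
    then have "{x, y} = {5 + (y - 5), 5 + (y - 5 + 2) mod 5}" "y - 5 < 5" by auto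
    then show ?thesis unfolding petersen_def edges_def snd_conv by blast
  next
    case 5 then show ?thesis unfolding petersen_def edges_def snd_conv by blast
  next
    case 6 then show ?thesis unfolding petersen_def edges_def snd_conv by blast
  qed
qed

lemma prism_edge_iff:
  "{x, y} \<in> edges (prism n) \<longleftrightarrow>
     x < n \<and> y < n \<and> (y = (x + 1) mod n \<or> x = (y + 1) mod n) \<or>
     n \<le> x \<and> x < 2 * n \<and> n \<le> y \<and> y < 2 * n \<and> (y = n + (x - n + 1) mod n \<or> x = n + (y - n + 1) mod n) \<or>
     x < n \<and> y = n + x \<or> y < n \<and> x = n + y" (is "?L \<longleftrightarrow> ?R")
proof
  assume ?L
  then show ?R by (auto simp: prism_def edges_def doubleton_eq_iff)
next
  assume ?R
  then consider "x < n" "y = (x + 1) mod n" | "y < n" "x = (y + 1) mod n"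
    | "n \<le> x" "x < 2 * n" "y = n + (x - n + 1) mod n"
    | "n \<le> y" "y < 2 * n" "x = n + (y - n + 1) mod n"
    | "x < n" "y = n + x" | "y < n" "x = n + y"
    by blast
  then show ?L
  proof cases
    case 1 then show ?thesis unfolding prism_def edges_def snd_conv by blast
  next
    case 2 then show ?thesis unfolding prism_def edges_def snd_conv by blast
  next
    case 3
    then have "{x, y} = {n + (x - n), n + (x - n + 1) mod n}" "x - n < n" by auto
    then show ?thesis unfolding prism_def edges_def snd_conv by blast
  next
    case 4
    then have "{x, y} = {n + (y - n), n + (y - n + 1) mod n}" "y - n < n" by auto
    then show ?thesis unfolding prism_def edges_def snd_conv by blast
  next
    case 5 then show ?thesis unfolding prism_def edges_def snd_conv by blast
  next
    case 6 then show ?thesis unfolding prism_def edges_def snd_conv by blast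
  qed
qed

text \<open>Written without \<open>mod\<close>, so that linear arithmetic can decide it for variable
  \<open>n\<close>; the last two disjuncts are the closing edge between \<open>n - 1\<close> and
  \<open>0\<close>.\<close>

definition cycle_adj :: "nat \<Rightarrow> nat \<Rightarrow> nat \<Rightarrow> bool" where
  "cycle_adj n i j \<longleftrightarrow> i < n \<and> j < n \<and> (j = i + 1 \<or> i = j + 1 \<or> i = 0 \<and> j + 1 = n \<or> j = 0 \<and> i + 1 = n)"

lemma prism_edge_cycle_adj:
  "{x, y} \<in> edges (prism n) \<longleftrightarrow>
     cycle_adj n x y \<or> n \<le> x \<and> n \<le> y \<and> cycle_adj n (x - n) (y - n) \<or>
     x < n \<and> y = n + x \<or> y < n \<and> x = n + y"
proof -
  have m: "j = (i + 1) mod n \<longleftrightarrow> i + 1 < n \<and> j = i + 1 \<or> i + 1 = n \<and> j = 0" if "i < n" for i j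
  proof (cases "i + 1 = n")
    case True
    then show ?thesis by auto
  next
    case False
    then have "i + 1 < n" using that by simp
    then show ?thesis by auto
  qed
  have 1: "x < n \<and> y < n \<and> (y = (x + 1) mod n \<or> x = (y + 1) mod n) \<longleftrightarrow> cycle_adj n x y" for x y
    using m[of x y] m[of y x] by (auto simp: cycle_adj_def)
  have 2: "n \<le> x \<and> x < 2 * n \<and> n \<le> y \<and> y < 2 * n \<and> (y = n + (x - n + 1) mod n \<or> x = n + (y - n + 1) mod n)
    \<longleftrightarrow> n \<le> x \<and> n \<le> y \<and> cycle_adj n (x - n) (y - n)"
  proof (cases "n \<le> x \<and> n \<le> y")
    case True
    then obtain i j where "x = n + i" "y = n + j" by (auto simp: le_iff_add)
    then show ?thesis unfolding 1[symmetric] by simp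
  qed auto
  show ?thesis unfolding prism_edge_iff 1 2 ..
qed

lemma verts_prism: "verts (prism n) = {0..<2 * n}"
  by (simp add: prism_def verts_def)

lemma verts_petersen: "verts petersen = {0..<10}"
  by (simp add: petersen_def verts_def)

lemma rep_ge3_petersen: "rep_ge3 petersen"
  \<comment> \<open>The walks off 1 and 4 reach the leaf 5 through its inner neighbours 8 and 7; the
    walk off 5 stays on the outer cycle.\<close>
  by (rule claw_rep_ge3[of 0 _ 1 4 5 "[4, 3, 8, 5]" "[1, 2, 7, 5]" "[1, 2, 3, 4]"])
    (simp_all add: linked_off_def verts_petersen petersen_edge_iff)

text \<open>The leaves of the claw at 0 are its two cycle neighbours and its copy \<open>n\<close>.
  The walk off \<open>n\<close> is the first cycle without 0, the other two pass through the second
  cycle. For \<open>n = 3\<close> the leaves 1 and \<open>n - 1\<close> would be adjacent.\<close>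

lemma rep_ge3_prism_ge4:
  assumes "n \<ge> 4"
  shows "rep_ge3 (prism n)"
proof (rule claw_rep_ge3[of 0 _ 1 "n - 1" n "[n - 1, n + (n - 1), n]" "[1, n + 1, n]" "[1..<n]"])
  show "linked_off (prism n) n [1..<n]"
    using assms
    by (auto simp: linked_off_def verts_prism prism_edge_cycle_adj cycle_adj_def
        successively_conv_nth distinct_adj_conv_nth)
qed (use assms in \<open>auto simp: linked_off_def verts_prism prism_edge_cycle_adj cycle_adj_def\<close>)

text \<open>The sum over \<open>i \<noteq> j\<close> in the triangle of the equations for the nonadjacent pairs
  \<open>i, 3 + j\<close> with the common neighbour \<open>j\<close> leaves an odd number of edge equations.\<close>
lemma rep_ge3_prism_3: "rep_ge3 (prism 3)"
proof (rule rep_ge3I[of 0 _ 4])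
  show "\<not> k_word_representable 2 (prism 3)"
  proof
    assume "k_word_representable 2 (prism 3)"
    then obtain \<beta> where \<beta>: "naji_solution (prism 3) \<beta>" using naji_solution_exists by blast
    have 1: "\<beta> v w \<noteq> \<beta> w v" if "v < 6" "w < 6" "v \<noteq> w" "{v, w} \<in> edges (prism 3)" for v w
      using \<beta> that by (auto simp: naji_solution_def verts_prism)
    have 2: "\<beta> x v = \<beta> x w" if "x < 6" "v < 6" "w < 6" "x \<noteq> v" "x \<noteq> w" "v \<noteq> w"
      "{v, w} \<in> edges (prism 3)" "{x, v} \<notin> edges (prism 3)" "{x, w} \<notin> edges (prism 3)" for x v w
      using \<beta> that by (auto simp: naji_solution_def verts_prism)
    have 3: "(\<beta> v w \<noteq> \<beta> w v) = (\<beta> x v = \<beta> x w)" if "x < 6" "v < 6" "w < 6" "x \<noteq> v" "x \<noteq> w" "v \<noteq> w"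
      "{v, w} \<notin> edges (prism 3)" "{x, v} \<in> edges (prism 3)" "{x, w} \<in> edges (prism 3)" for x v w
      using \<beta> that by (auto simp: naji_solution_def verts_prism)
    note adj = prism_edge_cycle_adj cycle_adj_def
    have "\<beta> 0 1 \<noteq> \<beta> 1 0" "\<beta> 0 2 \<noteq> \<beta> 2 0" "\<beta> 1 2 \<noteq> \<beta> 2 1"
      by (rule 1; simp add: adj)+
    moreover have "\<beta> 0 4 = \<beta> 0 5" "\<beta> 1 3 = \<beta> 1 5" "\<beta> 2 3 = \<beta> 2 4"
      "\<beta> 3 1 = \<beta> 3 2" "\<beta> 4 0 = \<beta> 4 2" "\<beta> 5 0 = \<beta> 5 1"
      by (rule 2; simp add: adj)+
    moreover have "(\<beta> 0 4 \<noteq> \<beta> 4 0) = (\<beta> 1 0 = \<beta> 1 4)" "(\<beta> 0 5 \<noteq> \<beta> 5 0) = (\<beta> 2 0 = \<beta> 2 5)"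
      "(\<beta> 1 3 \<noteq> \<beta> 3 1) = (\<beta> 0 1 = \<beta> 0 3)" "(\<beta> 1 5 \<noteq> \<beta> 5 1) = (\<beta> 2 1 = \<beta> 2 5)"
      "(\<beta> 2 3 \<noteq> \<beta> 3 2) = (\<beta> 0 2 = \<beta> 0 3)" "(\<beta> 2 4 \<noteq> \<beta> 4 2) = (\<beta> 1 2 = \<beta> 1 4)"
      by (rule 3; simp add: adj)+
    ultimately show False by argo
  qed
qed (auto simp: verts_prism prism_edge_cycle_adj cycle_adj_def)

section \<open>The two operations\<close>

text \<open>Deleting the letters outside \<open>G\<close> changes neither the restriction to two
  remaining letters nor the number of their occurrences.\<close>

lemma induced_k_word_representable:
  assumes "k_word_representable k H" "verts G \<subseteq> verts H"
    and "\<And>x y. x \<in> verts G \<Longrightarrow> y \<in> verts G \<Longrightarrow> {x, y} \<in> edges G \<longleftrightarrow> {x, y} \<in> edges H"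
  shows "k_word_representable k G"
proof -
  obtain w where w: "uniform k w" "represents w H"
    using assms(1) by (auto simp: k_word_representable_def)
  let ?u = "filter (\<lambda>z. z \<in> verts G) w"
  have "set ?u = verts G" using w(2) assms(2) by (auto simp: represents_def)
  moreover have "alternate ?u x y = alternate w x y" if "x \<in> verts G" "y \<in> verts G" for x y
  proof -
    have "filter (\<lambda>z. z = x \<or> z = y) ?u = filter (\<lambda>z. z = x \<or> z = y) w"
      using that unfolding filter_filter by (intro filter_cong) auto
    then show ?thesis by (simp only: alternate_def)
  qed
  ultimately have "represents ?u G" using w(2) assms(2,3) unfolding represents_def by blast
  moreover have "uniform k ?u"
    unfolding uniform_def
  proof
    fix x assume x: "x \<in> set ?u"
    then have "filter ((=) x) ?u = filter ((=) x) w"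
      unfolding filter_filter by (intro filter_cong) auto
    then show "count_list ?u x = k"
      using w(1) x by (simp add: count_list_eq_length_filter uniform_def)
  qed
  ultimately show ?thesis by (auto simp: k_word_representable_def)
qed

definition add_leaf :: "graph \<Rightarrow> nat \<Rightarrow> nat \<Rightarrow> graph" where
  "add_leaf G v u = (insert u (verts G), insert {v, u} (edges G))"

definition add_path3 :: "graph \<Rightarrow> nat \<Rightarrow> nat \<Rightarrow> nat \<Rightarrow> nat \<Rightarrow> graph" where
  "add_path3 G x u t y = (insert u (insert t (verts G)), {{x, u}, {u, t}, {t, y}} \<union> edges G)"

lemma filter_remove_letters:
  assumes "a \<notin> X" "b \<notin> X" "filter (\<lambda>z. z \<notin> X) w' = filter (\<lambda>z. z \<notin> X) w"
  shows "filter (\<lambda>z. z = a \<or> z = b) w' = filter (\<lambda>z. z = a \<or> z = b) w"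
proof -
  have "filter (\<lambda>z. z = a \<or> z = b) w = filter (\<lambda>z. z = a \<or> z = b) (filter (\<lambda>z. z \<notin> X) w)" for w
    using assms(1,2) unfolding filter_filter by (intro filter_cong) auto
  then show ?thesis using assms(3) by metis
qed

lemma count_list_split3:
  assumes "count_list w v = 3"
  obtains A B C D where "w = A @ v # B @ v # C @ v # D"
    "v \<notin> set A" "v \<notin> set B" "v \<notin> set C" "v \<notin> set D"
proof -
  have "v \<in> set w" using assms count_list_0_iff[of w v] by auto
  then obtain A w1 where 1: "w = A @ v # w1" "v \<notin> set A" by (meson split_list_first)
  then have c: "count_list w1 v = 2" using assms by (simp add: count_list_0_iff)
  then have "v \<in> set w1" using count_list_0_iff[of w1 v] by auto
  then obtain B w2 where 2: "w1 = B @ v # w2" "v \<notin> set B" by (meson split_list_first)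
  then have c: "count_list w2 v = 1" using c by (simp add: count_list_0_iff)
  then have "v \<in> set w2" using count_list_0_iff[of w2 v] by auto
  then obtain C D where 3: "w2 = C @ v # D" "v \<notin> set C" by (meson split_list_first)
  then have "count_list D v = 0" using c by (simp add: count_list_0_iff)
  then show thesis using that[of A B C D] 1 2 3 by (simp add: count_list_0_iff)
qed

lemma filter_pair_eq_Nil:
  "u \<notin> set A \<Longrightarrow> v \<notin> set A \<Longrightarrow> filter (\<lambda>z. z = u \<or> z = v) A = []"
  by (auto simp: filter_empty_conv)

lemma filter_neq_id: "u \<notin> set L \<Longrightarrow> filter (\<lambda>z. z \<noteq> u) L = L"
  by (intro filter_True) auto

text \<open>Since deleting \<open>X\<close> from \<open>w'\<close> returns \<open>w\<close>, pairs
  of old letters behave as before; by symmetry of alternation only pairs whose first letter is new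
  remain to be checked.\<close>

lemma represents_extend:
  assumes rep: "represents w G"
    and V: "verts H = verts G \<union> X" "X \<inter> verts G = {}" and setw: "set w' = verts H"
    and old: "filter (\<lambda>z. z \<notin> X) w' = w"
    and oldE: "\<And>x y. x \<in> verts G \<Longrightarrow> y \<in> verts G \<Longrightarrow> {x, y} \<in> edges H \<longleftrightarrow> {x, y} \<in> edges G"
    and new: "\<And>x y. x \<in> X \<Longrightarrow> y \<in> verts H \<Longrightarrow> x \<noteq> y \<Longrightarrow> alternate w' x y \<longleftrightarrow> {x, y} \<in> edges H"
  shows "represents w' H"
  unfolding represents_def
proof (intro conjI ballI impI)
  fix x y assume xy: "x \<in> verts H" "y \<in> verts H" "x \<noteq> y"
  consider "x \<in> X" | "y \<in> X" | "x \<in> verts G" "y \<in> verts G" using xy V by auto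
  then show "alternate w' x y \<longleftrightarrow> {x, y} \<in> edges H"
  proof cases
    case 1
    then show ?thesis using new xy by blast
  next
    case 2
    then show ?thesis using new[of y x] xy by (simp add: alternate_commute insert_commute)
  next
    case 3
    have "filter (\<lambda>z. z \<notin> X) w = w"
      using rep V by (intro filter_True) (auto simp: represents_def)
    then have "filter (\<lambda>z. z = x \<or> z = y) w' = filter (\<lambda>z. z = x \<or> z = y) w"
      using 3 V old by (intro filter_remove_letters[of _ X]) auto
    then have "alternate w' x y = alternate w x y" by (simp only: alternate_def)
    then show ?thesis using oldE 3 rep xy by (auto simp: represents_def)
  qed
qed (rule setw)

lemma not_distinct_adj_append2: "\<not> distinct_adj (A @ u # u # B)"
  by (simp add: distinct_adj_append_iff)

lemma add_leaf_3_word_representable: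
  assumes "k_word_representable 3 G" "simple_graph G" "v \<in> verts G" "u \<notin> verts G"
  shows "k_word_representable 3 (add_leaf G v u)"
proof -
  obtain w where w: "uniform 3 w" "represents w G"
    using assms(1) by (auto simp: k_word_representable_def)
  have vert: "set w = verts G" using w(2) by (simp add: represents_def)
  have "count_list w v = 3" using w(1) assms(3) vert by (auto simp: uniform_def)
  then obtain A B C D where spl: "w = A @ v # B @ v # C @ v # D"
    "v \<notin> set A" "v \<notin> set B" "v \<notin> set C" "v \<notin> set D" by (rule count_list_split3)
  define w' where "w' = A @ [u, v, u] @ B @ v # C @ [u, v] @ D"
  have u: "u \<notin> set A" "u \<notin> set B" "u \<notin> set C" "u \<notin> set D" "u \<noteq> v"
    using assms(4) vert spl(1) by auto
  have noedge: "{z, u} \<notin> edges G" "{u, z} \<notin> edges G" for z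
    using assms(2,4) by (auto simp: simple_graph_def doubleton_eq_iff)
  have keep: "filter (\<lambda>z. z \<notin> {u}) w' = w"
    using u by (simp add: w'_def spl(1) filter_neq_id)
  have "represents w' (add_leaf G v u)"
  proof (rule represents_extend[OF w(2), of _ "{u}"])
    show "set w' = verts (add_leaf G v u)"
      using vert by (auto simp: w'_def spl(1) add_leaf_def verts_def)
    show "filter (\<lambda>z. z \<notin> {u}) w' = w" by (rule keep)
    fix x y assume xy: "x \<in> {u}" "y \<in> verts (add_leaf G v u)" "x \<noteq> y"
    show "alternate w' x y \<longleftrightarrow> {x, y} \<in> edges (add_leaf G v u)"
    proof (cases "y = v")
      case True
      \<comment> \<open>The copies of \<open>u\<close> stand before and after the first
        \<open>v\<close> and before the last one.\<close>
      have "filter (\<lambda>z. z = u \<or> z = v) w' = [u, v, u, v, u, v]"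
        using u spl by (simp add: w'_def filter_pair_eq_Nil)
      then show ?thesis
        using xy True u by (simp add: alternate_iff_distinct_adj add_leaf_def edges_def insert_commute)
    next
      case False
      \<comment> \<open>Here \<open>v\<close> is filtered out, and the factor \<open>u v u\<close>
        becomes \<open>u u\<close>.\<close>
      have "\<not> distinct_adj (filter (\<lambda>z. z = u \<or> z = y) w')"
        using False u by (simp add: w'_def not_distinct_adj_append2)
      then show ?thesis
        using xy False noedge
        by (auto simp: alternate_iff_distinct_adj add_leaf_def edges_def doubleton_eq_iff)
    qed
  qed (use assms u in \<open>auto simp: add_leaf_def verts_def edges_def doubleton_eq_iff\<close>)
  moreover have "uniform 3 w'"
    unfolding uniform_def
  proof
    fix z assume "z \<in> set w'"
    then have "z = u \<or> z \<in> set w" by (auto simp: w'_def spl(1))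
    then show "count_list w' z = 3"
    proof
      assume "z \<in> set w"
      then have "count_list w z = 3" "z \<noteq> u" using w(1) assms(4) vert by (auto simp: uniform_def)
      then show ?thesis by (auto simp: w'_def spl(1))
    qed (use u in \<open>simp add: w'_def count_list_0_iff\<close>)
  qed
  ultimately show ?thesis by (auto simp: k_word_representable_def)
qed

section \<open>Joining two vertices by a path of length 3\<close>

lemma filter_pair_replicate:
  "u \<notin> set L \<Longrightarrow> filter (\<lambda>z. z = u \<or> z = a) L = replicate (count_list L a) a"
  by (induction L) auto

text \<open>A factor of the filtered word lifts to a factor of \<open>w\<close> with the same ends:
  letters skipped before \<open>a\<close> go into \<open>A\<close>, those skipped before
  \<open>b\<close> into \<open>B\<close>.\<close>

lemma filter_window:
  assumes "filter P w = pre @ a # mid @ b # post"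
  shows "\<exists>A B C. w = A @ a # B @ b # C \<and> filter P B = mid"
proof -
  obtain A w1 where 1: "w = A @ w1" "filter P w1 = a # mid @ b # post"
    using filter_eq_appendD[OF assms] by blast
  obtain A' w2 where 2: "w1 = A' @ a # w2" "filter P w2 = mid @ b # post"
    using filter_eq_ConsD[OF 1(2)] by metis
  obtain B w3 where 3: "w2 = B @ w3" "filter P B = mid" "filter P w3 = b # post"
    using filter_eq_appendD[OF 2(2)] by blast
  obtain B' C where 4: "w3 = B' @ b # C" "\<forall>z\<in>set B'. \<not> P z"
    using filter_eq_ConsD[OF 3(3)] by metis
  have "w = (A @ A') @ a # (B @ B') @ b # C" "filter P (B @ B') = mid"
    using 1 2 3 4 by (auto simp: filter_empty_conv)
  then show ?thesis by blast
qed

text \<open>As each letter occurs three times, an odd number of the pairs \<open>c1 c4\<close>,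
  \<open>c2 c5\<close>, \<open>c3 c6\<close> is unequal. Without a window, a single unequal pair
  would force four equal letters, and three unequal pairs would force \<open>c2 = c5\<close>. The
  proof runs through the possible values of the six letters instead.\<close>

lemma balanced_window:
  assumes "length c = 6" "set c \<subseteq> {x, y}" "count_list c x = 3" "count_list c y = 3" "x \<noteq> y"
  shows "\<exists>pre a m1 m2 b post. c = pre @ a # [m1, m2] @ b # post \<and> a \<noteq> b \<and> m1 \<noteq> m2"
proof -
  obtain c1 c2 c3 c4 c5 c6 where c: "c = [c1, c2, c3, c4, c5, c6]"
    using assms(1) by (auto simp: numeral_eq_Suc length_Suc_conv)
  have "c1 = x \<or> c1 = y" "c2 = x \<or> c2 = y" "c3 = x \<or> c3 = y" "c4 = x \<or> c4 = y"
    "c5 = x \<or> c5 = y" "c6 = x \<or> c6 = y"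
    using assms(2) by (auto simp: c)
  moreover have "count_list [c1, c2, c3, c4, c5, c6] x = 3" "count_list [c1, c2, c3, c4, c5, c6] y = 3"
    using assms(3,4) by (simp_all only: c)
  ultimately have "c1 \<noteq> c4 \<and> c2 \<noteq> c3 \<or> c2 \<noteq> c5 \<and> c3 \<noteq> c4 \<or> c3 \<noteq> c6 \<and> c4 \<noteq> c5"
    using assms(5) by (elim disjE) simp_all
  then consider "c1 \<noteq> c4 \<and> c2 \<noteq> c3" | "c2 \<noteq> c5 \<and> c3 \<noteq> c4" | "c3 \<noteq> c6 \<and> c4 \<noteq> c5" by blast
  then show ?thesis
  proof cases
    case 1
    have "c = [] @ c1 # [c2, c3] @ c4 # [c5, c6]" by (simp add: c)
    then show ?thesis using 1 by blast
  next
    case 2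
    have "c = [c1] @ c2 # [c3, c4] @ c5 # [c6]" by (simp add: c)
    then show ?thesis using 2 by blast
  next
    case 3
    have "c = [c1, c2] @ c3 # [c4, c5] @ c6 # []" by (simp add: c)
    then show ?thesis using 3 by blast
  qed
qed

lemma count_list_filter: "P x \<Longrightarrow> count_list (filter P w) x = count_list w x"
  by (induction w) auto

text \<open>The restriction to \<open>x\<close> and \<open>y\<close> has length six and thus
  contains a balanced window; its two middle letters differ, so the lifted factor \<open>B\<close>
  contains each letter once.\<close>

lemma uniform3_window:
  assumes "count_list w x = 3" "count_list w y = 3" "x \<noteq> y"
  shows "\<exists>A B C a b. w = A @ a # B @ b # C \<and> {a, b} = {x, y} \<and> count_list B x = 1 \<and> count_list B y = 1"
proof -
  let ?P = "\<lambda>z. z = x \<or> z = y"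
  let ?c = "filter ?P w"
  have "length (filter (\<lambda>z. z = x \<or> z = y) w) = count_list w x + count_list w y"
    using assms(3) by (induction w) auto
  then have "length ?c = 6" using assms by simp
  moreover have s: "set ?c \<subseteq> {x, y}" by auto
  ultimately obtain pre a m1 m2 b post where
    c: "?c = pre @ a # [m1, m2] @ b # post" "a \<noteq> b" "m1 \<noteq> m2"
    using balanced_window[of ?c x y] assms by (auto simp: count_list_filter)
  have "{a, m1, m2, b} \<subseteq> {x, y}" using s unfolding c(1) by simp
  then have ab: "{a, b} = {x, y}" "{m1, m2} = {x, y}" using c(2,3) by auto
  obtain A B C where w: "w = A @ a # B @ b # C" "filter ?P B = [m1, m2]"
    using filter_window[OF c(1)] by blast
  have "count_list B z = count_list [m1, m2] z" if "z \<in> {x, y}" for z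
    using that count_list_filter[of ?P z B] by (auto simp: w(2))
  then have "count_list B x = 1" "count_list B y = 1"
    using ab(2) c(3) assms(3) by (auto simp: doubleton_eq_iff)
  then show ?thesis using w(1) ab(1) by blast
qed

text \<open>The new word restricts to \<open>u a u a u\<close> with the remaining \<open>a\<close>
  before or after it, to \<open>t b t b t\<close> with the remaining \<open>b\<close> likewise, and
  to \<open>u t u t u t\<close>. Any other letter leaves \<open>u u\<close> from the block
  \<open>u a t u\<close>, or \<open>t t\<close> from \<open>t b u t\<close>.\<close>

lemma add_path3_window:
  assumes w: "uniform 3 w" "represents w G" and simple: "simple_graph G"
    and spl: "w = A @ a # B @ b # C" "a \<noteq> b" "count_list B a = 1" "count_list B b = 1"
    and new: "u \<notin> verts G" "t \<notin> verts G" "u \<noteq> t"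
  shows "k_word_representable 3 (add_path3 G a u t b)"
proof -
  define w' where "w' = A @ [u, a, t, u] @ B @ [t, b, u, t] @ C"
  let ?H = "add_path3 G a u t b"
  have vert: "set w = verts G" using w(2) by (simp add: represents_def)
  have u: "u \<notin> set A" "u \<notin> set B" "u \<notin> set C" "t \<notin> set A" "t \<notin> set B" "t \<notin> set C"
      "u \<noteq> a" "u \<noteq> b" "t \<noteq> a" "t \<noteq> b"
    using new vert spl(1) by auto
  have ab: "a \<in> verts G" "b \<in> verts G" using vert spl(1) by auto
  have noedge: "{z, u} \<notin> edges G" "{u, z} \<notin> edges G" "{z, t} \<notin> edges G" "{t, z} \<notin> edges G" for z
    using simple new by (auto simp: simple_graph_def doubleton_eq_iff)
  have "count_list w a = 3" "count_list w b = 3" using w(1) ab vert by (auto simp: uniform_def)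
  \<comment> \<open>One \<open>a\<close> is displayed and one lies in \<open>B\<close>, which leaves
    a single one for \<open>A\<close> or \<open>C\<close>; the same holds for
    \<open>b\<close>.\<close>
  then have cnt: "count_list A a = 0 \<and> count_list C a = 1 \<or> count_list A a = 1 \<and> count_list C a = 0"
      "count_list A b = 0 \<and> count_list C b = 1 \<or> count_list A b = 1 \<and> count_list C b = 0"
    using spl by auto
  have keep: "filter (\<lambda>z. z \<notin> {u, t}) w' = w"
  proof -
    have "filter (\<lambda>z. z \<notin> {u, t}) L = L" if "u \<notin> set L" "t \<notin> set L" for L
      using that by (intro filter_True) auto
    then show ?thesis using u by (simp add: w'_def spl(1))
  qed
  have alt_u: "alternate w' u y \<longleftrightarrow> y = a \<or> y = t" if "y \<noteq> u" for y
  proof -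
    consider "y = a" | "y = t" | "y \<noteq> a" "y \<noteq> t" by blast
    then show ?thesis
    proof cases
      case 1
      then show ?thesis
        using u new spl cnt(1) that
        by (auto simp: alternate_iff_distinct_adj w'_def filter_pair_replicate)
    next
      case 2
      then show ?thesis
        using u new that by (auto simp: alternate_iff_distinct_adj w'_def filter_pair_eq_Nil)
    next
      case 3
      then show ?thesis
        using u that by (simp add: alternate_iff_distinct_adj w'_def not_distinct_adj_append2)
    qed
  qed
  have alt_t: "alternate w' t y \<longleftrightarrow> y = b \<or> y = u" if "y \<noteq> t" for y
  proof -
    consider "y = b" | "y = u" | "y \<noteq> b" "y \<noteq> u" by blast
    then show ?thesis
    proof cases
      case 1
      then show ?thesis
        using u new spl cnt(2) that
        by (auto simp: alternate_iff_distinct_adj w'_def filter_pair_replicate)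
    next
      case 2
      then show ?thesis
        using alt_u[of t] new(3) alternate_commute[of w' t u] by simp
    next
      case 3
      let ?f = "filter (\<lambda>z. z = t \<or> z = y)"
      \<comment> \<open>The double \<open>t\<close> comes from the second inserted block, so
        everything up to \<open>B\<close> belongs to the prefix.\<close>
      have "\<exists>L R. ?f w' = L @ t # t # R"
      proof (intro exI)
        show "?f w' = ?f (A @ [u, a, t, u] @ B) @ t # t # ?f C"
          using u new 3 that by (simp add: w'_def)
      qed
      then show ?thesis
        using 3 that by (auto simp: alternate_iff_distinct_adj not_distinct_adj_append2)
    qed
  qed
  have "represents w' ?H"
  proof (rule represents_extend[OF w(2), of _ "{u, t}"])
    show "set w' = verts ?H"
      using vert by (auto simp: w'_def spl(1) add_path3_def verts_def)
    show "filter (\<lambda>z. z \<notin> {u, t}) w' = w" by (rule keep)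
    fix x y assume "x \<in> {u, t}" "y \<in> verts ?H" "x \<noteq> y"
    then show "alternate w' x y \<longleftrightarrow> {x, y} \<in> edges ?H"
      using alt_u[of y] alt_t[of y] u new(3) noedge
      by (auto simp: add_path3_def edges_def doubleton_eq_iff)
  qed (use new u ab in \<open>auto simp: add_path3_def verts_def edges_def doubleton_eq_iff\<close>)
  moreover have "uniform 3 w'"
    unfolding uniform_def
  proof
    fix z assume "z \<in> set w'"
    then have "z = u \<or> z = t \<or> z \<in> set w" by (auto simp: w'_def spl(1))
    then show "count_list w' z = 3"
    proof (elim disjE)
      assume "z \<in> set w"
      then have "count_list w z = 3" "z \<noteq> u" "z \<noteq> t" using w(1) new vert by (auto simp: uniform_def)
      then show ?thesis by (auto simp: w'_def spl(1))
    qed (use u new in \<open>auto simp: w'_def count_list_0_iff\<close>)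
  qed
  ultimately show ?thesis by (auto simp: k_word_representable_def)
qed

lemma add_path3_3_word_representable:
  assumes "k_word_representable 3 G" "simple_graph G" "x \<in> verts G" "y \<in> verts G" "x \<noteq> y"
    and new: "u \<notin> verts G" "t \<notin> verts G" "u \<noteq> t"
  shows "k_word_representable 3 (add_path3 G x u t y)"
proof -
  obtain w where w: "uniform 3 w" "represents w G"
    using assms(1) by (auto simp: k_word_representable_def)
  have "count_list w x = 3" "count_list w y = 3"
    using w assms(3,4) by (auto simp: uniform_def represents_def)
  then obtain A B C a b where spl: "w = A @ a # B @ b # C" "{a, b} = {x, y}"
    "count_list B x = 1" "count_list B y = 1"
    using uniform3_window[OF _ _ assms(5)] by blast
  consider "a = x" "b = y" | "a = y" "b = x" using spl(2) by (auto simp: doubleton_eq_iff)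
  then show ?thesis
  proof cases
    case 1
    then show ?thesis using add_path3_window[OF w assms(2) spl(1)] spl assms by auto
  next
    case 2
    \<comment> \<open>The window has the two letters in the other order, so the path is read from
      \<open>y\<close> to \<open>x\<close>, which exchanges \<open>u\<close> and
      \<open>t\<close>.\<close>
    then have "k_word_representable 3 (add_path3 G y t u x)"
      using add_path3_window[OF w assms(2) spl(1)] spl assms by auto
    moreover have "add_path3 G y t u x = add_path3 G x u t y"
      by (auto simp: add_path3_def insert_commute)
    ultimately show ?thesis by simp
  qed
qed

section \<open>Words for the base graphs\<close>

text \<open>The word consists of \<open>n\<close> blocks \<open>q, q-1, q-2, (q-3)', q', (q-1)'\<close> with indices
  modulo \<open>n\<close>; \<open>prism_letter n q r\<close> is the letter at place \<open>r < 6\<close> of block \<open>q < n\<close>.\<close>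
definition prism_letter :: "nat \<Rightarrow> nat \<Rightarrow> nat \<Rightarrow> nat" where
  "prism_letter n q r =
    (if r = 0 then q
     else if r = 1 then (if q \<ge> 1 then q - 1 else q + n - 1)
     else if r = 2 then (if q \<ge> 2 then q - 2 else q + n - 2)
     else if r = 3 then (if q \<ge> 3 then n + q - 3 else n + q + n - 3)
     else if r = 4 then n + q
     else (if q \<ge> 1 then n + q - 1 else n + q + n - 1))"

definition prism_word :: "nat \<Rightarrow> nat list" where
  "prism_word n = map (\<lambda>p. prism_letter n (p div 6) (p mod 6)) [0..<6 * n]"

text \<open>Kept as a constant, so that positions are compared lexicographically by block and place
  rather than by arithmetic.\<close>

definition block_pos :: "nat \<Rightarrow> nat \<Rightarrow> nat" where
  "block_pos q r = 6 * q + r"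

lemma block_pos_eq_iff: "r < 6 \<Longrightarrow> s < 6 \<Longrightarrow> block_pos q r = block_pos p s \<longleftrightarrow> q = p \<and> r = s"
  unfolding block_pos_def by presburger

lemma block_pos_less_iff: "r < 6 \<Longrightarrow> s < 6 \<Longrightarrow> block_pos q r < block_pos p s \<longleftrightarrow> q < p \<or> q = p \<and> r < s"
  unfolding block_pos_def by presburger

text \<open>Modulo \<open>n\<close>, vertex \<open>i\<close> stands at places 0, 1, 2 of blocks
  \<open>i, i + 1, i + 2\<close>, and its copy \<open>n + i\<close> at places 4, 5, 3 of blocks
  \<open>i, i + 1, i + 3\<close>. Each disjunct is one way of wrapping around, with the positions
  sorted.\<close>

definition prism_positions :: "nat \<Rightarrow> nat \<Rightarrow> nat \<Rightarrow> nat \<Rightarrow> nat \<Rightarrow> bool" where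
  "prism_positions n x a b c \<longleftrightarrow>
     x + 3 \<le> n \<and> a = block_pos x 0 \<and> b = block_pos (x + 1) 1 \<and> c = block_pos (x + 2) 2 \<or>
     n = x + 2 \<and> a = block_pos 0 2 \<and> b = block_pos x 0 \<and> c = block_pos (x + 1) 1 \<or>
     n = x + 1 \<and> a = block_pos 0 1 \<and> b = block_pos 1 2 \<and> c = block_pos x 0 \<or>
     (\<exists>i. x = n + i \<and> (i + 4 \<le> n \<and> a = block_pos i 4 \<and> b = block_pos (i + 1) 5 \<and> c = block_pos (i + 3) 3 \<or>
       n = i + 3 \<and> a = block_pos 0 3 \<and> b = block_pos i 4 \<and> c = block_pos (i + 1) 5 \<or>
       n = i + 2 \<and> a = block_pos 1 3 \<and> b = block_pos i 4 \<and> c = block_pos (i + 1) 5 \<or>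
       n = i + 1 \<and> a = block_pos 0 5 \<and> b = block_pos 2 3 \<and> c = block_pos i 4))"

lemma prism_positions_exist:
  assumes "n \<ge> 5" "x < 2 * n"
  obtains a b c where "prism_positions n x a b c"
proof -
  consider "x + 3 \<le> n" | "n = x + 2" | "n = x + 1" | i where "x = n + i" "i + 4 \<le> n"
    | i where "x = n + i" "n = i + 3" | i where "x = n + i" "n = i + 2" | i where "x = n + i" "n = i + 1"
  proof (cases "x < n")
    case True
    then show ?thesis using that(1-3) by linarith
  next
    case False
    then obtain i where "x = n + i" by (metis add_diff_inverse_nat)
    moreover have "i + 4 \<le> n \<or> n = i + 3 \<or> n = i + 2 \<or> n = i + 1" using \<open>x = n + i\<close> assms by linarith
    ultimately show ?thesis using that(4-7) by blast
  qed
  then show thesis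
    by cases (auto intro!: that simp: prism_positions_def)
qed

lemma prism_positions_less:
  "n \<ge> 5 \<Longrightarrow> prism_positions n x a b c \<Longrightarrow> a < b \<and> b < c"
  by (auto simp: prism_positions_def block_pos_less_iff)

lemma prism_letter_iff:
  assumes "n \<ge> 5" "prism_positions n x a b c" "q < n" "r < 6"
  shows "prism_letter n q r = x \<longleftrightarrow> block_pos q r = a \<or> block_pos q r = b \<or> block_pos q r = c"
proof -
  consider "r = 0" | "r = 1" | "r = 2" | "r = 3" | "r = 4" | "r = 5" using assms(4) by linarith
  then show ?thesis
    using assms(1-3) unfolding prism_positions_def prism_letter_def
    by cases (elim disjE conjE exE; simp add: block_pos_eq_iff; linarith)+
qed

lemma occurrences_prism_word:
  assumes "n \<ge> 5" "prism_positions n x a b c"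
  shows "occurrences (prism_word n) x = {a, b, c}"
proof -
  have bound: "a < 6 * n" "b < 6 * n" "c < 6 * n"
    using assms by (auto simp: prism_positions_def block_pos_def)
  have letter: "prism_letter n (p div 6) (p mod 6) = x \<longleftrightarrow> p = a \<or> p = b \<or> p = c" if "p < 6 * n" for p
    using prism_letter_iff[OF assms, of "p div 6" "p mod 6"] that by (simp add: less_mult_imp_div_less mult.commute block_pos_def)
  have "occurrences (prism_word n) x = {p. p < 6 * n \<and> prism_letter n (p div 6) (p mod 6) = x}"
    by (auto simp: occurrences_def prism_word_def)
  also have "\<dots> = {p. p < 6 * n \<and> (p = a \<or> p = b \<or> p = c)}" using letter by blast
  finally show ?thesis using bound by auto
qed

lemma separates_triples:
  fixes a b c d e f :: nat
  assumes "a < b" "b < c" "d < e" "e < f" "{a, b, c} \<inter> {d, e, f} = {}"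
  shows "separates {d, e, f} {a, b, c} \<and> separates {a, b, c} {d, e, f} \<longleftrightarrow>
    a < d \<and> d < b \<and> b < e \<and> e < c \<and> c < f \<or> d < a \<and> a < e \<and> e < b \<and> b < f \<and> f < c"
proof
  assume *: "separates {d, e, f} {a, b, c} \<and> separates {a, b, c} {d, e, f}"
  \<comment> \<open>Each of the four gaps between neighbours of a triple contains a point of the
    other triple; only the two strictly interleaved orders satisfy all four conditions.\<close>
  then have "a < d \<and> d < b \<or> a < e \<and> e < b \<or> a < f \<and> f < b" "b < d \<and> d < c \<or> b < e \<and> e < c \<or> b < f \<and> f < c"
    "d < a \<and> a < e \<or> d < b \<and> b < e \<or> d < c \<and> c < e" "e < a \<and> a < f \<or> e < b \<and> b < f \<or> e < c \<and> c < f"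
    using assms(1-4) by (auto simp: separates_def)
  then show "a < d \<and> d < b \<and> b < e \<and> e < c \<and> c < f \<or> d < a \<and> a < e \<and> e < b \<and> b < f \<and> f < c"
    using assms by (elim disjE conjE) simp_all
next
  assume "a < d \<and> d < b \<and> b < e \<and> e < c \<and> c < f \<or> d < a \<and> a < e \<and> e < b \<and> b < f \<and> f < c"
  then show "separates {d, e, f} {a, b, c} \<and> separates {a, b, c} {d, e, f}"
    by (elim disjE conjE) (auto simp: separates_def)
qed

text \<open>Without wrapping, writing (block, place), the vertices \<open>i\<close> and
  \<open>i + 1\<close> give (i,0), (i+1,0), (i+1,1), (i+2,1), (i+2,2), (i+3,2), and \<open>i\<close>
  with its copy gives (i,0), (i,4), (i+1,1), (i+1,5), (i+2,2), (i+3,3), alternately from the two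
  vertices. The seven forms of each triple leave 49 cases, decided by comparing blocks and then
  places.\<close>

lemma prism_positions_interleave:
  assumes "n \<ge> 5" "x \<noteq> y" "prism_positions n x a b c" "prism_positions n y d e f"
  shows "(a < d \<and> d < b \<and> b < e \<and> e < c \<and> c < f \<or> d < a \<and> a < e \<and> e < b \<and> b < f \<and> f < c)
    \<longleftrightarrow> {x, y} \<in> edges (prism n)"
  using assms(3,4) unfolding prism_positions_def
  by (elim disjE conjE exE)
    (use assms(1,2) in \<open>auto simp: block_pos_less_iff prism_edge_cycle_adj cycle_adj_def\<close>)

lemma prism_word_represents:
  assumes "n \<ge> 5"
  shows "represents (prism_word n) (prism n)" "uniform 3 (prism_word n)"
proof -
  have occ: "\<exists>a b c. prism_positions n x a b c \<and> occurrences (prism_word n) x = {a, b, c} \<and> a < b \<and> b < c"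
    if "x < 2 * n" for x
    using prism_positions_exist[OF assms that] occurrences_prism_word[OF assms] prism_positions_less[OF assms]
    by metis
  have set: "set (prism_word n) = {0..<2 * n}"
  proof
    show "{0..<2 * n} \<subseteq> set (prism_word n)"
    proof
      fix x assume "x \<in> {0..<2 * n}"
      then obtain a where "a \<in> occurrences (prism_word n) x" using occ[of x] by auto
      then show "x \<in> set (prism_word n)" by (auto simp: occurrences_def)
    qed
    have "prism_letter n q r < 2 * n" if "q < n" for q r
      using that assms by (auto simp: prism_letter_def)
    then show "set (prism_word n) \<subseteq> {0..<2 * n}"
      by (auto simp: prism_word_def less_mult_imp_div_less mult.commute)
  qed
  show "uniform 3 (prism_word n)"
    unfolding uniform_def set
  proof
    fix x assume "x \<in> {0..<2 * n}"
    then obtain a b c where "occurrences (prism_word n) x = {a, b, c}" "a < b" "b < c"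
      using occ[of x] by auto
    then show "count_list (prism_word n) x = 3"
      using card_occurrences[of "prism_word n" x] by simp
  qed
  show "represents (prism_word n) (prism n)"
    unfolding represents_def set verts_prism
  proof (intro conjI ballI impI refl)
    fix x y assume "x \<in> {0..<2 * n}" "y \<in> {0..<2 * n}" and xy: "x \<noteq> y"
    then obtain a b c d e f where
      1: "prism_positions n x a b c" "occurrences (prism_word n) x = {a, b, c}" "a < b" "b < c" and
      2: "prism_positions n y d e f" "occurrences (prism_word n) y = {d, e, f}" "d < e" "e < f"
      using occ[of x] occ[of y] by auto
    have "{a, b, c} \<inter> {d, e, f} = {}"
      using occurrences_disjoint[of _ "prism_word n" x y] xy unfolding 1(2) 2(2) by blast
    then show "alternate (prism_word n) x y \<longleftrightarrow> {x, y} \<in> edges (prism n)"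
      using separates_triples[OF 1(3,4) 2(3,4)] prism_positions_interleave[OF assms xy 1(1) 2(1)]
      by (simp add: alternate_iff_separates[OF xy] 1(2) 2(2))
  qed
qed

section \<open>Explicit words for the small base graphs\<close>

lemma prism_3_word:
  "represents [4, 1, 3, 5, 4, 0, 3, 2, 1, 0, 5, 4, 3, 2, 5, 1, 0, 2] (prism 3)"
  (is "represents ?w _")
proof -
  have set: "set ?w = {0..<6}" by (simp add: atLeast0_lessThan_Suc numeral_eq_Suc) auto
  \<comment> \<open>A finite check: for every pair of letters the simplifier filters the word and
    looks for equal neighbours.\<close>
  have "\<forall>x\<in>set ?w. \<forall>y\<in>set ?w. x \<noteq> y \<longrightarrow> (alternate ?w x y \<longleftrightarrow> {x, y} \<in> edges (prism 3))"
    by (simp add: alternate_iff_distinct_adj prism_edge_cycle_adj cycle_adj_def)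
  then show ?thesis unfolding represents_def verts_prism set by simp
qed

lemma prism_4_word:
  "represents [1, 5, 2, 0, 1, 7, 6, 4, 5, 3, 7, 0, 4, 2, 1, 3, 0, 6, 2, 7, 5, 3, 4, 6] (prism 4)"
  (is "represents ?w _")
proof -
  have set: "set ?w = {0..<8}" by (simp add: atLeast0_lessThan_Suc numeral_eq_Suc) auto
  have "\<forall>x\<in>set ?w. \<forall>y\<in>set ?w. x \<noteq> y \<longrightarrow> (alternate ?w x y \<longleftrightarrow> {x, y} \<in> edges (prism 4))"
    by (simp add: alternate_iff_distinct_adj prism_edge_cycle_adj cycle_adj_def)
  then show ?thesis unfolding represents_def verts_prism set by simp
qed

lemma petersen_word:
  "represents [0, 2, 7, 6, 1, 8, 5, 9, 6, 3, 8, 2, 4, 3, 0, 1, 7, 2, 9, 6, 5, 7, 4, 9, 0, 8, 3, 4, 5, 1] petersen"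
  (is "represents ?w _")
proof -
  have set: "set ?w = {0..<10}" by (simp add: atLeast0_lessThan_Suc numeral_eq_Suc) auto
  have "\<forall>x\<in>set ?w. \<forall>y\<in>set ?w. x \<noteq> y \<longrightarrow> (alternate ?w x y \<longleftrightarrow> {x, y} \<in> edges petersen)"
    by (simp add: alternate_iff_distinct_adj petersen_edge_iff)
  then show ?thesis unfolding represents_def verts_petersen set by simp
qed

section \<open>Graphs with representation number 3\<close>

text \<open>The invariant for the induction over derived graphs; \<open>simple_graph\<close> ensures
  that a new vertex lies on no old edge.\<close>

definition rep_number_3 :: "graph \<Rightarrow> bool" where
  "rep_number_3 G \<longleftrightarrow> simple_graph G \<and> k_word_representable 3 G \<and> rep_ge3 G"

lemma rep_number_3_imp_R_class:
  assumes "rep_number_3 G"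
  shows "G \<in> R_class 3"
proof -
  have "rep_number G = 3"
    unfolding rep_number_def
  proof (rule Least_equality)
    fix k assume "k_word_representable k G"
    then show "3 \<le> k" using assms unfolding rep_number_3_def rep_ge3_def by (meson not_le)
  qed (use assms in \<open>simp add: rep_number_3_def\<close>)
  then show ?thesis
    using assms
    by (auto simp: R_class_def rep_number_3_def word_representable_def k_word_representable_def)
qed

lemma rep_number_3_petersen: "rep_number_3 petersen"
proof -
  have "simple_graph petersen"
    unfolding simple_graph_def
  proof (intro conjI ballI)
    fix e assume "e \<in> edges petersen"
    then consider i where "e = {i, (i + 1) mod 5}" "i < 5"
      | i where "e = {5 + i, 5 + (i + 2) mod 5}" "i < 5" | i where "e = {i, 5 + i}" "i < 5"
      by (auto simp: edges_def petersen_def)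
    then obtain a b where "e = {a, b}" "a \<noteq> b" "a < 10" "b < 10"
    proof cases
      case 1
      have "i \<noteq> (i + 1) mod 5" by presburger
      then show ?thesis using 1 that[of i "(i + 1) mod 5"] by simp
    next
      case 2
      have "i \<noteq> (i + 2) mod 5" by presburger
      then show ?thesis using 2 that[of "5 + i" "5 + (i + 2) mod 5"] by simp
    next
      case 3
      then show ?thesis using that[of i "5 + i"] by simp
    qed
    then show "\<exists>x y. x \<in> verts petersen \<and> y \<in> verts petersen \<and> x \<noteq> y \<and> e = {x, y}"
      unfolding verts_petersen by (intro exI[of _ a] exI[of _ b]) simp
  qed (simp add: verts_petersen)
  moreover have "k_word_representable 3 petersen"
    using petersen_word by (auto simp: k_word_representable_def uniform_def intro!: exI)
  ultimately show ?thesis using rep_ge3_petersen by (simp add: rep_number_3_def)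
qed

lemma rep_number_3_prism:
  assumes "n \<ge> 3"
  shows "rep_number_3 (prism n)"
proof -
  have m: "i \<noteq> (i + 1) mod n \<and> (i + 1) mod n < n \<and> (i + 1) mod n < 2 * n" if "i < n" for i
    using that assms by (cases "i + 1 = n") auto
  have "simple_graph (prism n)"
    unfolding simple_graph_def
  proof (intro conjI ballI)
    fix e assume "e \<in> edges (prism n)"
    then consider i where "e = {i, (i + 1) mod n}" "i < n"
      | i where "e = {n + i, n + (i + 1) mod n}" "i < n" | i where "e = {i, n + i}" "i < n"
      by (auto simp: edges_def prism_def)
    then obtain a b where "e = {a, b}" "a \<noteq> b" "a < 2 * n" "b < 2 * n"
    proof cases
      case 1
      then show ?thesis using m[of i] that[of i "(i + 1) mod n"] by simp
    next
      case 2
      then show ?thesis using m[of i] that[of "n + i" "n + (i + 1) mod n"] by simp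
    next
      case 3
      then show ?thesis using that[of i "n + i"] by simp
    qed
    then show "\<exists>x y. x \<in> verts (prism n) \<and> y \<in> verts (prism n) \<and> x \<noteq> y \<and> e = {x, y}"
      unfolding verts_prism by (intro exI[of _ a] exI[of _ b]) simp
  qed (simp add: verts_prism)
  moreover have "k_word_representable 3 (prism n)"
  proof -
    consider "n = 3" | "n = 4" | "n \<ge> 5" using assms by linarith
    then show ?thesis
    proof cases
      case 1
      then show ?thesis using prism_3_word by (auto simp: k_word_representable_def uniform_def intro!: exI)
    next
      case 2
      then show ?thesis using prism_4_word by (auto simp: k_word_representable_def uniform_def intro!: exI)
    next
      case 3
      then show ?thesis using prism_word_represents by (auto simp: k_word_representable_def)
    qed
  qed
  moreover have "rep_ge3 (prism n)"
    using assms rep_ge3_prism_3 rep_ge3_prism_ge4[of n] by (cases "n = 3") auto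
  ultimately show ?thesis by (simp add: rep_number_3_def)
qed

section \<open>Preservation under the operations\<close>

lemma simple_graph_insert_vertex: "simple_graph (V, E) \<Longrightarrow> simple_graph (insert u V, E)"
  unfolding simple_graph_def verts_def edges_def fst_conv snd_conv by blast

lemma simple_graph_insert_edge:
  assumes "simple_graph (V, E)" "x \<in> V" "y \<in> V" "x \<noteq> y"
  shows "simple_graph (V, insert {x, y} E)"
  unfolding simple_graph_def verts_def edges_def fst_conv snd_conv
proof (intro conjI ballI)
  show "finite V" using assms(1) by (simp add: simple_graph_def verts_def)
  fix e assume "e \<in> insert {x, y} E"
  then consider "e = {x, y}" | "e \<in> E" by blast
  then show "\<exists>x y. x \<in> V \<and> y \<in> V \<and> x \<noteq> y \<and> e = {x, y}"
  proof cases
    case 1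
    then show ?thesis using assms(2-4) by (intro exI[of _ x] exI[of _ y]) simp
  next
    case 2
    then show ?thesis using assms(1) by (simp add: simple_graph_def verts_def edges_def)
  qed
qed

text \<open>A word for \<open>H\<close> restricts to a word for \<open>G\<close> with the same
  uniformity, so the lower bound moves upwards.\<close>

lemma rep_ge3_induced:
  assumes "rep_ge3 G" "verts G \<subseteq> verts H"
    and "\<And>x y. x \<in> verts G \<Longrightarrow> y \<in> verts G \<Longrightarrow> {x, y} \<in> edges G \<longleftrightarrow> {x, y} \<in> edges H"
  shows "rep_ge3 H"
  using assms(1) induced_k_word_representable[OF _ assms(2,3)] unfolding rep_ge3_def by blast

lemma rep_number_3_add_leaf:
  assumes "rep_number_3 G" "v \<in> verts G" "u \<notin> verts G"
  shows "rep_number_3 (add_leaf G v u)"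
proof -
  have "u \<noteq> v" using assms by auto
  then have "simple_graph (add_leaf G v u)"
    using assms unfolding rep_number_3_def add_leaf_def
    by (intro simple_graph_insert_edge simple_graph_insert_vertex) (auto simp: verts_def edges_def)
  moreover have "rep_ge3 (add_leaf G v u)"
    by (rule rep_ge3_induced[of G])
      (use assms in \<open>auto simp: rep_number_3_def add_leaf_def verts_def edges_def doubleton_eq_iff\<close>)
  ultimately show ?thesis
    using assms add_leaf_3_word_representable by (simp add: rep_number_3_def)
qed

lemma rep_number_3_add_path3:
  assumes "rep_number_3 G" "x \<in> verts G" "y \<in> verts G" "x \<noteq> y"
    and "u \<notin> verts G" "t \<notin> verts G" "u \<noteq> t"
  shows "rep_number_3 (add_path3 G x u t y)"
proof -
  have "x \<noteq> u" "t \<noteq> y" using assms by auto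
  then have "simple_graph (add_path3 G x u t y)"
    using assms unfolding rep_number_3_def add_path3_def Un_insert_left Un_empty_left
    by (intro simple_graph_insert_edge simple_graph_insert_vertex) (auto simp: verts_def edges_def)
  moreover have "rep_ge3 (add_path3 G x u t y)"
    \<comment> \<open>Each of the three new edges contains a new vertex, so \<open>G\<close> stays
      induced.\<close>
    by (rule rep_ge3_induced[of G])
      (use assms in \<open>auto simp: rep_number_3_def add_path3_def verts_def edges_def doubleton_eq_iff\<close>)
  ultimately show ?thesis
    using assms add_path3_3_word_representable by (simp add: rep_number_3_def)
qed

lemma path_edges_single [simp]: "path_edges [x] = {}"
  by (simp add: path_edges_def)

text \<open>Index 0 gives the first edge and a shift of the other indices gives the rest; this
  recursion is what the inductions along paths use.\<close>

lemma path_edges_Cons_Cons [simp]: "path_edges (x # y # p) = insert {x, y} (path_edges (y # p))"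
proof -
  have "path_edges (x # y # p) = (\<lambda>i. {(x # y # p) ! i, (y # p) ! i}) ` {..<Suc (length p)}"
    by (auto simp: path_edges_def)
  also have "\<dots> = insert {x, y} ((\<lambda>i. {(y # p) ! i, p ! i}) ` {..<length p})"
    unfolding lessThan_Suc_eq_insert_0 by (simp add: image_image)
  also have "(\<lambda>i. {(y # p) ! i, p ! i}) ` {..<length p} = path_edges (y # p)"
    by (auto simp: path_edges_def)
  finally show ?thesis .
qed

text \<open>The path grows leaf by leaf; each new leaf becomes the vertex to which the rest is
  attached, hence the generalization over \<open>G\<close> and \<open>v\<close>.\<close>

lemma rep_number_3_attach_path:
  assumes "rep_number_3 G" "v \<in> verts G" "distinct p" "set p \<inter> verts G = {}"
  shows "rep_number_3 (verts G \<union> set p, edges G \<union> path_edges (v # p))"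
  using assms
proof (induction p arbitrary: G v)
  case Nil
  then show ?case by (simp add: verts_def edges_def)
next
  case (Cons u p)
  have "rep_number_3 (add_leaf G v u)" using Cons.prems by (intro rep_number_3_add_leaf) auto
  then have "rep_number_3 (verts (add_leaf G v u) \<union> set p, edges (add_leaf G v u) \<union> path_edges (u # p))"
    using Cons.prems by (intro Cons.IH) (auto simp: add_leaf_def verts_def)
  then show ?case by (simp add: add_leaf_def verts_def edges_def)
qed

text \<open>Leaves are attached from \<open>x\<close> onwards until two internal vertices remain,
  and then a path of length 3 closes the gap to \<open>y\<close>. The moving end stays distinct from
  \<open>y\<close>, since it is a new vertex.\<close>

lemma rep_number_3_join_path:
  assumes "rep_number_3 G" "x \<in> verts G" "y \<in> verts G" "x \<noteq> y" "length p \<ge> 2"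
    "distinct p" "set p \<inter> verts G = {}"
  shows "rep_number_3 (verts G \<union> set p, edges G \<union> path_edges (x # p @ [y]))"
  using assms
proof (induction p arbitrary: G x)
  case (Cons u p)
  show ?case
  proof (cases "length p \<ge> 2")
    case True
    have "rep_number_3 (add_leaf G x u)" using Cons.prems by (intro rep_number_3_add_leaf) auto
    then have "rep_number_3 (verts (add_leaf G x u) \<union> set p,
        edges (add_leaf G x u) \<union> path_edges (u # p @ [y]))"
      using Cons.prems True by (intro Cons.IH) (auto simp: add_leaf_def verts_def)
    then show ?thesis by (simp add: add_leaf_def verts_def edges_def)
  next
    case False
    then have "length p = 1" using Cons.prems(5) by simp
    then obtain t where p: "p = [t]" by (auto simp: length_Suc_conv)
    have "rep_number_3 (add_path3 G x u t y)"
      using Cons.prems p by (intro rep_number_3_add_path3) auto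
    then show ?thesis by (simp add: p add_path3_def insert_commute)
  qed
qed simp

lemma derived_graphs_rep_number_3: "G \<in> derived_graphs \<Longrightarrow> rep_number_3 G"
  by (induction rule: derived_graphs.induct)
    (simp_all add: rep_number_3_petersen rep_number_3_prism rep_number_3_attach_path rep_number_3_join_path)

theorem theorem13:
  shows "petersen \<in> R_class 3 \<and> (\<forall>n\<ge>3. prism n \<in> R_class 3) \<and> derived_graphs \<subseteq> R_class 3"
  using rep_number_3_petersen rep_number_3_prism derived_graphs_rep_number_3 rep_number_3_imp_R_class
  by blast

end
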